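(* Let $\mathcal{H}_{\mathrm r}\ne\{0\}$, $\gamma>0$, $T>0$, and $K_\gamma(t):=\gamma e^{-\gamma t}I$, where $I$ is the identity on $\mathcal{H}_{\mathrm r}$. Then $$\int_0^T\big((K_\gamma*x)(t),x(t)\big)\,dt\ge0$$ for every $x\in L^2(0,T;\mathcal{H}_{\mathrm r})$, but there is no constant $c_T>0$ such that $$\int_0^T\big((K_\gamma*x)(t),x(t)\big)\,dt\ge c_T\|x\|_{L^2(0,T;\mathcal{H}_{\mathrm r})}^2$$ for all $x\in L^2(0,T;\mathcal{H}_{\mathrm r})$.
   Context: $\mathcal{H}_{\mathrm r}$ is a separable real Hilbert space with inner product $(\cdot,\cdot)$. For an operator-valued kernel $K$, $(K*x)(t):=\int_0^tK(t-s)x(s)\,ds$. *)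

theory Defs
  imports "HOL-Analysis.Analysis"
begin

(* L^2(M; H), with functions in place of their almost-everywhere classes; all integrals below
   depend only on the class.  For separable H, Borel measurability is the same as strong
   (Bochner) measurability. *)

definition L2_space ::
    "'s measure \<Rightarrow> ('s \<Rightarrow> 'h::{real_inner, banach, second_countable_topology}) set" where
  "L2_space M = {x \<in> borel_measurable M. integrable M (\<lambda>t. (norm (x t))\<^sup>2)}"

definition L2_norm ::
    "'s measure \<Rightarrow> ('s \<Rightarrow> 'h::{real_inner, banach, second_countable_topology}) \<Rightarrow> real" where
  "L2_norm M x = sqrt (\<integral>t. (norm (x t))\<^sup>2 \<partial>M)"

definition conv ::
    "(real \<Rightarrow> 'h \<Rightarrow>\<^sub>L 'h) \<Rightarrow> (real \<Rightarrow> 'h) \<Rightarrow> real \<Rightarrow> 'h::{real_inner, banach, second_countable_topology}" where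
  "conv K x t = (\<integral>s. blinfun_apply (K (t - s)) (x s) \<partial>lebesgue_on {0<..<t})"

definition exp_kernel :: "real \<Rightarrow> real \<Rightarrow> 'h \<Rightarrow>\<^sub>L 'h::{real_inner, banach, second_countable_topology}" where
  "exp_kernel \<gamma> t = (\<gamma> * exp (- \<gamma> * t)) *\<^sub>R id_blinfun"

end

theory Submission
  imports Defs
begin

text \<open>
  By symmetry the form equals half of the double integral of
  \<open>\<gamma> exp (- \<gamma> \<bar>t - s\<bar>) (x s \<bullet> x t)\<close> over the square. The kernel is positive
  semidefinite because \<open>exp (- \<gamma> \<bar>t - s\<bar>) = exp (- \<gamma> (s + t)) min (exp (2 \<gamma> s)) (exp (2 \<gamma> t))\<close>
  and \<open>min a b\<close> is the integral over \<open>u > 0\<close> of the product of the indicators of \<open>u < a\<close> and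
  \<open>u < b\<close>; Fubini turns the double integral into an integral over \<open>u\<close> of squared norms. Coercivity
  fails on a fixed vector switched on during \<open>(0, d)\<close>: the form is of order \<open>d\<^sup>2\<close>, the squared norm
  of order \<open>d\<close>.
\<close>

section \<open>Double integrals with bounded, positive semidefinite and symmetric kernels\<close>

text \<open>By Cauchy-Schwarz the integrand is dominated by
  \<open>C * (norm (x s) * norm (x t))\<close>, a product of integrable functions of separate
  variables. It supplies the integrability that every later exchange of integrals relies on.\<close>

lemma integrable_pair_inner:
  fixes x :: "'a \<Rightarrow> 'h::{real_inner, banach, second_countable_topology}"
  assumes "finite_measure M" and x: "integrable M x"
    and k: "k \<in> borel_measurable (M \<Otimes>\<^sub>M M)"
    and bound: "\<And>s t. s \<in> space M \<Longrightarrow> t \<in> space M \<Longrightarrow> \<bar>k (s, t)\<bar> \<le> C"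
  shows "integrable (M \<Otimes>\<^sub>M M) (\<lambda>(s, t). k (s, t) * (x s \<bullet> x t))"
proof -
  interpret finite_measure M by fact
  interpret pair_sigma_finite M M ..
  have [measurable]: "x \<in> borel_measurable M" using x by auto
  have [measurable]: "k \<in> borel_measurable (M \<Otimes>\<^sub>M M)" by fact
  have "integrable (M \<Otimes>\<^sub>M M) (\<lambda>p. C * (norm (x (fst p)) * norm (x (snd p))))"
  proof (rule Fubini_integrable)
    show "AE s in M. integrable M (\<lambda>t. C * (norm (x (fst (s, t))) * norm (x (snd (s, t)))))"
      using x by auto
    show "integrable M (\<lambda>s. \<integral>t. norm (C * (norm (x (fst (s, t))) * norm (x (snd (s, t))))) \<partial>M)"
      using x by (simp add: abs_mult)
  qed measurable
  then show ?thesis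
  proof (rule Bochner_Integration.integrable_bound)
    show "AE p in M \<Otimes>\<^sub>M M. norm (case p of (s, t) \<Rightarrow> k (s, t) * (x s \<bullet> x t))
        \<le> norm (C * (norm (x (fst p)) * norm (x (snd p))))"
    proof (rule AE_I2)
      fix p assume "p \<in> space (M \<Otimes>\<^sub>M M)"
      then obtain s t where p: "p = (s, t)" "s \<in> space M" "t \<in> space M"
        by (auto simp: space_pair_measure)
      have "\<bar>k (s, t)\<bar> * \<bar>x s \<bullet> x t\<bar> \<le> C * (norm (x s) * norm (x t))"
        using bound[OF p(2,3)] Cauchy_Schwarz_ineq2[of "x s" "x t"]
        by (intro mult_mono) auto
      then show "norm (case p of (s, t) \<Rightarrow> k (s, t) * (x s \<bullet> x t))
          \<le> norm (C * (norm (x (fst p)) * norm (x (snd p))))"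
        using abs_ge_self[of "C * (norm (x s) * norm (x t))"] by (simp add: p abs_mult)
    qed
  qed measurable
qed

text \<open>For fixed \<open>u\<close> the kernel \<open>\<phi> u s * \<phi> u t\<close> has rank
  one, so its form is the squared norm of the integral of \<open>\<phi> u s *\<^sub>R x s\<close>
  over \<open>s\<close>. Fubini moves the integral over \<open>u\<close> to the outside, where a
  nonnegative function is integrated.\<close>

lemma psd_kernel_integral_nonneg:
  fixes x :: "'a \<Rightarrow> 'h::{real_inner, banach, second_countable_topology}" and \<phi> :: "'b \<Rightarrow> 'a \<Rightarrow> real"
  assumes N: "finite_measure N" and M: "finite_measure M" and x: "integrable M x"
    and \<phi>: "(\<lambda>(u, s). \<phi> u s) \<in> borel_measurable (N \<Otimes>\<^sub>M M)"
    and bound: "\<And>u s. u \<in> space N \<Longrightarrow> s \<in> space M \<Longrightarrow> \<bar>\<phi> u s\<bar> \<le> C"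
  shows "0 \<le> (\<integral>t. \<integral>s. (\<integral>u. \<phi> u s * \<phi> u t \<partial>N) * (x s \<bullet> x t) \<partial>M \<partial>M)"
proof -
  interpret N: finite_measure N by fact
  interpret M: finite_measure M by fact
  interpret MM: pair_sigma_finite M M ..
  interpret NMM: pair_sigma_finite N "M \<Otimes>\<^sub>M M" 
    by (simp add: pair_sigma_finite_def MM.sigma_finite_measure_axioms N.sigma_finite_measure_axioms)
  note \<phi>[measurable]
  have [measurable]: "x \<in> borel_measurable M" using x by auto
  have C2: "\<bar>\<phi> u s * \<phi> u t\<bar> \<le> C * C" if "u \<in> space N" "s \<in> space M" "t \<in> space M" for u s t
    unfolding abs_mult using bound[of u s] bound[of u t] that by (intro mult_mono) auto
  \<comment> \<open>The applied abstraction on \<open>(s, t)\<close> keeps the integrand in the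
    shape \<open>k (s, t) * (x s \<bullet> x t)\<close>, so that \<open>k\<close> can be read off by
    unification.\<close>
  have int_u: "integrable (M \<Otimes>\<^sub>M M) (\<lambda>(s, t). (\<lambda>(s, t). \<phi> u s * \<phi> u t) (s, t) * (x s \<bullet> x t))"
    if [measurable]: "u \<in> space N" for u
    by (rule integrable_pair_inner[where C = "C * C"]) (use M x C2 that in \<open>auto\<close>)
  \<comment> \<open>The triple integrand, with \<open>(s, t)\<close> bundled into one variable so
    that Fubini applies to \<open>N\<close> against the product of \<open>M\<close> with
    itself.\<close>
  define F where "F u p = (case p of (s, t) \<Rightarrow> \<phi> u s * \<phi> u t * (x s \<bullet> x t))" for u p
  have [measurable]: "(\<lambda>(u, p). F u p) \<in> borel_measurable (N \<Otimes>\<^sub>M (M \<Otimes>\<^sub>M M))"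
    unfolding F_def by measurable
  have F_int: "integrable (M \<Otimes>\<^sub>M M) (F u)" if "u \<in> space N" for u
    using int_u[OF that] by (simp add: F_def[abs_def] split_beta')
  \<comment> \<open>A majorant of \<open>F u\<close> that does not depend on \<open>u\<close>. The
    integral of its norm bounds the inner integrals by a constant, which is integrable over the
    finite measure \<open>N\<close>.\<close>
  have abs_int: "integrable (M \<Otimes>\<^sub>M M) (\<lambda>(s, t). (\<lambda>_. C * C) (s, t) * (x s \<bullet> x t))"
    by (rule integrable_pair_inner[where C = "C * C"]) (use M x in \<open>auto\<close>)
  have dom: "norm (F u p) \<le> norm (case p of (s, t) \<Rightarrow> C * C * (x s \<bullet> x t))"
    if "u \<in> space N" "p \<in> space (M \<Otimes>\<^sub>M M)" for u p
    using that C2[of u "fst p" "snd p"]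
    by (auto simp: F_def space_pair_measure abs_mult intro!: mult_right_mono)
  have F_pair: "integrable (N \<Otimes>\<^sub>M (M \<Otimes>\<^sub>M M)) (\<lambda>(u, p). F u p)"
  proof (rule NMM.Fubini_integrable)
    show "AE u in N. integrable (M \<Otimes>\<^sub>M M) (\<lambda>p. case (u, p) of (u, p) \<Rightarrow> F u p)"
      using F_int by auto
    show "integrable N (\<lambda>u. \<integral>p. norm (case (u, p) of (u, p) \<Rightarrow> F u p) \<partial>(M \<Otimes>\<^sub>M M))"
    proof (rule N.integrable_const_bound)
      show "AE u in N. norm (\<integral>p. norm (case (u, p) of (u, p) \<Rightarrow> F u p) \<partial>(M \<Otimes>\<^sub>M M))
          \<le> (\<integral>p. norm (case p of (s, t) \<Rightarrow> C * C * (x s \<bullet> x t)) \<partial>(M \<Otimes>\<^sub>M M))"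
      proof (rule AE_I2)
        fix u assume u: "u \<in> space N"
        have "(\<integral>p. norm (F u p) \<partial>(M \<Otimes>\<^sub>M M))
            \<le> (\<integral>p. norm (case p of (s, t) \<Rightarrow> C * C * (x s \<bullet> x t)) \<partial>(M \<Otimes>\<^sub>M M))"
          by (rule integral_mono[OF integrable_norm[OF F_int[OF u]]])
            (use abs_int integrable_norm dom[OF u] in \<open>auto\<close>)
        then show "norm (\<integral>p. norm (case (u, p) of (u, p) \<Rightarrow> F u p) \<partial>(M \<Otimes>\<^sub>M M))
          \<le> (\<integral>p. norm (case p of (s, t) \<Rightarrow> C * C * (x s \<bullet> x t)) \<partial>(M \<Otimes>\<^sub>M M))"
          by simp
      qed
    qed measurable
  qed measurable
  have F_u: "integral\<^sup>L (M \<Otimes>\<^sub>M M) (F u) = (norm (\<integral>s. \<phi> u s *\<^sub>R x s \<partial>M))\<^sup>2" if u[measurable]: "u \<in> space N" for u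
  proof -
    have \<phi>x: "integrable M (\<lambda>s. \<phi> u s *\<^sub>R x s)"
    proof (rule Bochner_Integration.integrable_bound[where f = "\<lambda>s. C *\<^sub>R x s"])
      show "AE s in M. norm (\<phi> u s *\<^sub>R x s) \<le> norm (C *\<^sub>R x s)"
        using bound[OF u] by (intro AE_I2) (fastforce intro!: mult_right_mono)
    qed (use x in \<open>auto\<close>)
    have "integral\<^sup>L (M \<Otimes>\<^sub>M M) (F u) = (\<integral>t. \<integral>s. \<phi> u s * \<phi> u t * (x s \<bullet> x t) \<partial>M \<partial>M)"
      using MM.integral_snd[of "\<lambda>s t. F u (s, t)"] F_int[OF u] by (simp add: F_def[abs_def])
    \<comment> \<open>The vector \<open>\<phi> u t *\<^sub>R x t\<close> is constant in
      \<open>s\<close>, so the inner product commutes with the integral over \<open>s\<close>; the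
      next step does the same in \<open>t\<close>.\<close>
    also have "\<dots> = (\<integral>t. (\<integral>s. \<phi> u s *\<^sub>R x s \<partial>M) \<bullet> (\<phi> u t *\<^sub>R x t) \<partial>M)"
      by (subst integral_inner_left[symmetric]) (use \<phi>x in \<open>auto simp: mult_ac\<close>)
    also have "\<dots> = (norm (\<integral>s. \<phi> u s *\<^sub>R x s \<partial>M))\<^sup>2"
      using \<phi>x by (subst integral_inner_right) (auto simp: power2_norm_eq_inner)
    finally show ?thesis .
  qed
  have k_int: "integrable (M \<Otimes>\<^sub>M M) (\<lambda>p. \<integral>u. F u p \<partial>N)"
    using NMM.integrable_snd[OF F_pair] .
  have "0 \<le> (\<integral>u. (\<integral>p. F u p \<partial>(M \<Otimes>\<^sub>M M)) \<partial>N)"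
    by (rule Bochner_Integration.integral_nonneg) (simp add: F_u)
  also have "\<dots> = (\<integral>p. (\<integral>u. F u p \<partial>N) \<partial>(M \<Otimes>\<^sub>M M))"
    by (rule NMM.Fubini_integral[symmetric, OF F_pair])
  also have "\<dots> = (\<integral>t. \<integral>s. (\<integral>u. F u (s, t) \<partial>N) \<partial>M \<partial>M)"
    using MM.integral_snd[of "\<lambda>s t. \<integral>u. F u (s, t) \<partial>N"] k_int by (simp add: split_beta')
  finally show ?thesis by (simp add: F_def)
qed

text \<open>Off the diagonal, \<open>G\<close> is the sum of its restriction to the triangle
  \<open>s < t\<close> and the transpose of that restriction. Both have the same integral by Fubini,
  and the diagonal contributes nothing because points are null. This links the causal convolution,
  which sees only \<open>s < t\<close>, to a form on the whole square.\<close>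

lemma triangle_integral_symmetric:
  fixes G :: "'a::linorder \<Rightarrow> 'a \<Rightarrow> real"
  assumes "sigma_finite_measure M"
    and lt: "Measurable.pred (M \<Otimes>\<^sub>M M) (\<lambda>(s, t). s < t)"
    and diffuse: "\<And>t. AE s in M. s \<noteq> t"
    and G: "integrable (M \<Otimes>\<^sub>M M) (\<lambda>(s, t). G s t)"
    and sym: "\<And>s t. G s t = G t s"
  shows "(\<integral>t. \<integral>s. G s t \<partial>M \<partial>M) = 2 * (\<integral>t. \<integral>s. (if s < t then G s t else 0) \<partial>M \<partial>M)"
proof -
  interpret sigma_finite_measure M by fact
  interpret pair_sigma_finite M M ..
  define L where "L s t = (if s < t then G s t else 0)" for s t
  have [measurable]: "(\<lambda>(s, t). G s t) \<in> borel_measurable (M \<Otimes>\<^sub>M M)" using G by auto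
  note lt[measurable]
  have L: "integrable (M \<Otimes>\<^sub>M M) (\<lambda>(s, t). L s t)"
    by (rule Bochner_Integration.integrable_bound[OF G]) (auto simp: L_def split_beta')
  note L' = integrable_product_swap[OF L]
  have swap: "(\<integral>t. \<integral>s. L s t \<partial>M \<partial>M) = (\<integral>t. \<integral>s. L t s \<partial>M \<partial>M)"
    using integral_snd[OF L] integral_fst[OF L] by simp
  have LR: "integrable (M \<Otimes>\<^sub>M M) (\<lambda>(s, t). L s t + L t s)"
    using Bochner_Integration.integrable_add[OF L L'] by (simp add: split_beta')
  have "(\<integral>t. \<integral>s. G s t \<partial>M \<partial>M) = (\<integral>t. \<integral>s. (L s t + L t s) \<partial>M \<partial>M)"
  proof (rule Bochner_Integration.integral_cong[OF refl])
    fix t assume t[measurable]: "t \<in> space M"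
    have [measurable]: "(\<lambda>s. G s t) \<in> borel_measurable M" "(\<lambda>s. L s t + L t s) \<in> borel_measurable M"
      using measurable_Pair2'[OF t] G LR
      by (auto simp: comp_def dest!: borel_measurable_integrable dest: measurable_Pair1[where y = t])
    show "(\<integral>s. G s t \<partial>M) = (\<integral>s. (L s t + L t s) \<partial>M)"
      \<comment> \<open>The two integrands can differ only at \<open>s = t\<close>, where the right
        one is zero; \<open>diffuse\<close> discards this point.\<close>
      by (rule integral_cong_AE) (use diffuse[of t] sym in \<open>auto simp: L_def\<close>)
  qed
  also have "\<dots> = (\<integral>p. (case p of (s, t) \<Rightarrow> L s t + L t s) \<partial>(M \<Otimes>\<^sub>M M))"
    by (rule integral_snd[OF LR])
  also have "\<dots> = (\<integral>p. (case p of (s, t) \<Rightarrow> L s t) \<partial>(M \<Otimes>\<^sub>M M)) + (\<integral>p. (case p of (s, t) \<Rightarrow> L t s) \<partial>(M \<Otimes>\<^sub>M M))"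
    using Bochner_Integration.integral_add[OF L L'] by (simp add: split_beta')
  also have "\<dots> = (\<integral>t. \<integral>s. L s t \<partial>M \<partial>M) + (\<integral>t. \<integral>s. L t s \<partial>M \<partial>M)"
    using integral_snd[OF L] integral_snd[OF L'] by simp
  finally show ?thesis using swap by (simp add: L_def)
qed

section \<open>Bounded intervals and the exponential kernel as a minimum\<close>

text \<open>Since \<open>n \<le> 1 + n\<^sup>2\<close>, the norm of \<open>x\<close> is dominated by
  \<open>1 + (norm (x t))\<^sup>2\<close>, and constants are integrable over a finite
  measure.\<close>

lemma L2_space_imp_integrable:
  assumes "finite_measure M" and "x \<in> L2_space M"
  shows "integrable M x"
proof (rule Bochner_Integration.integrable_bound)
  interpret finite_measure M by fact
  show "integrable M (\<lambda>t. 1 + (norm (x t))\<^sup>2)"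
    using assms by (auto simp: L2_space_def)
  show "x \<in> borel_measurable M" using assms by (auto simp: L2_space_def)
  have "n \<le> 1 + n\<^sup>2" for n :: real
    using zero_le_power2[of "n - 1"] zero_le_power2[of n] unfolding power2_diff one_power2 mult_1_right by linarith
  then show "AE t in M. norm (x t) \<le> norm (1 + (norm (x t))\<^sup>2)"
    by auto
qed

lemma finite_measure_lebesgue_on_Ioo: "finite_measure (lebesgue_on {a<..<b::real})"
  by (rule finite_measure_lebesgue_on) simp

text \<open>The product of the two cut-offs is \<open>exp (- \<gamma> * (s + t))\<close> on
  \<open>u < exp (2 * \<gamma> * min s t)\<close> and zero beyond; integrating gives the claim
  because \<open>2 * min s t - (s + t) = - \<bar>t - s\<bar>\<close>. Stopping the range of
  \<open>u\<close> at \<open>exp (2 * \<gamma> * T)\<close> makes its measure finite and loses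
  nothing, as \<open>s\<close> and \<open>t\<close> lie below \<open>T\<close>.\<close>

lemma exp_kernel_representation:
  fixes \<gamma> :: real
  assumes "\<gamma> > 0" "s < T" "t < T"
  shows "(\<integral>u. (if u < exp (2 * \<gamma> * s) then exp (- \<gamma> * s) else 0) *
      (if u < exp (2 * \<gamma> * t) then exp (- \<gamma> * t) else 0) \<partial>lebesgue_on {0<..<exp (2 * \<gamma> * T)})
    = exp (- \<gamma> * \<bar>t - s\<bar>)"
proof -
  define m where "m = min s t"
  have m: "exp (2 * \<gamma> * m) \<le> exp (2 * \<gamma> * T)" using assms by (auto simp: m_def)
  have "(if u < exp (2 * \<gamma> * s) then exp (- \<gamma> * s) else 0) * (if u < exp (2 * \<gamma> * t) then exp (- \<gamma> * t) else 0)
      = exp (- \<gamma> * (s + t)) * indicator {..<exp (2 * \<gamma> * m)} u" for u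
  proof -
    have "u < exp (2 * \<gamma> * m) \<longleftrightarrow> u < exp (2 * \<gamma> * s) \<and> u < exp (2 * \<gamma> * t)"
      using assms by (cases "s \<le> t") (auto simp: m_def min_def intro: less_le_trans)
    then show ?thesis
      by (auto simp: indicator_def mult_exp_exp algebra_simps)
  qed
  moreover have "measure (lebesgue_on {0<..<exp (2 * \<gamma> * T)}) {0<..<exp (2 * \<gamma> * m)} = exp (2 * \<gamma> * m)"
    using less_le_trans[OF _ m]
    by (subst measure_restrict_space) (auto simp del: exp_le_cancel_iff)
  moreover have "{..<exp (2 * \<gamma> * m)} \<inter> {0<..<exp (2 * \<gamma> * T)} = {0<..<exp (2 * \<gamma> * m)}"
    using m by (intro set_eqI) (simp del: exp_le_cancel_iff, linarith)
  ultimately have "(\<integral>u. (if u < exp (2 * \<gamma> * s) then exp (- \<gamma> * s) else 0) *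
      (if u < exp (2 * \<gamma> * t) then exp (- \<gamma> * t) else 0) \<partial>lebesgue_on {0<..<exp (2 * \<gamma> * T)})
      = exp (- \<gamma> * (s + t)) * exp (2 * \<gamma> * m)"
    by simp
  also have "\<dots> = exp (- \<gamma> * \<bar>t - s\<bar>)"
    by (auto simp: mult_exp_exp m_def min_def abs_if algebra_simps)
  finally show ?thesis .
qed

lemma lebesgue_on_id_measurable: "(\<lambda>s. s) \<in> borel_measurable (lebesgue_on (S :: real set))"
  by (simp add: measurable_completion measurable_restrict_space1)

lemma AE_lebesgue_on_neq: "AE s in lebesgue_on {a<..<b}. s \<noteq> (t::real)"
  using AE_completion[OF AE_lborel_singleton[of t]]
  by (subst AE_restrict_space_iff) (auto elim: eventually_mono)

section \<open>Nonnegativity of the convolution form\<close>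

text \<open>The moving domain of the convolution is traded for a cut-off \<open>s < t\<close> on the
  fixed interval, so that the form becomes an iterated integral over a square. On that cut-off
  \<open>t - s = \<bar>t - s\<bar>\<close>; the absolute value makes the kernel symmetric.\<close>

lemma conv_exp_kernel_inner:
  fixes x :: "real \<Rightarrow> 'h::{real_inner, banach, second_countable_topology}"
  assumes x: "integrable (lebesgue_on {0<..<T}) x" and t: "t < T" and "\<gamma> > 0"
  shows "conv (exp_kernel \<gamma>) x t \<bullet> x t =
    \<gamma> * (\<integral>s. (if s < t then exp (- \<gamma> * \<bar>t - s\<bar>) * (x s \<bullet> x t) else 0) \<partial>lebesgue_on {0<..<T})"
proof -
  have [measurable]: "x \<in> borel_measurable (lebesgue_on {0<..<T})" using x by auto
  note lebesgue_on_id_measurable[measurable]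
  let ?f = "\<lambda>s. indicator {..<t} s *\<^sub>R ((\<gamma> * exp (- \<gamma> * (t - s))) *\<^sub>R x s)"
  have "conv (exp_kernel \<gamma>) x t = (\<integral>s. ?f s \<partial>lebesgue_on {0<..<T})"
    unfolding conv_def exp_kernel_def using t
    by (simp add: integral_restrict_space indicator_def blinfun.scaleR_left if_distrib if_distribR)
       (rule Bochner_Integration.integral_cong, auto)
  \<comment> \<open>Integrability is what lets the inner product with \<open>x t\<close> pass under
    the integral. The exponential is at most one where the indicator is nonzero, so
    \<open>\<gamma> *\<^sub>R x s\<close> dominates.\<close>
  moreover have f: "integrable (lebesgue_on {0<..<T}) ?f"
  proof (rule Bochner_Integration.integrable_bound[where f = "\<lambda>s. \<gamma> *\<^sub>R x s"])
    have "norm (?f s) \<le> norm (\<gamma> *\<^sub>R x s)" for s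
      using \<open>\<gamma> > 0\<close> by (auto simp: indicator_def abs_mult intro!: mult_left_le_one_le)
    then show "AE s in lebesgue_on {0<..<T}. norm (?f s) \<le> norm (\<gamma> *\<^sub>R x s)" by simp
  qed (use x in \<open>auto\<close>)
  ultimately have "conv (exp_kernel \<gamma>) x t \<bullet> x t = (\<integral>s. ?f s \<bullet> x t \<partial>lebesgue_on {0<..<T})"
    using integral_inner_left[OF f, of "x t"] by metis
  also have "\<dots> = (\<integral>s. \<gamma> * (if s < t then exp (- \<gamma> * \<bar>t - s\<bar>) * (x s \<bullet> x t) else 0) \<partial>lebesgue_on {0<..<T})"
    by (rule Bochner_Integration.integral_cong) (auto simp: indicator_def)
  finally show ?thesis by simp
qed

lemma exp_kernel_form_nonneg:
  fixes x :: "real \<Rightarrow> 'h::{real_inner, banach, second_countable_topology}"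
  assumes "\<gamma> > 0" and x: "integrable (lebesgue_on {0<..<T}) x"
  shows "0 \<le> (\<integral>t. conv (exp_kernel \<gamma>) x t \<bullet> x t \<partial>lebesgue_on {0<..<T})"
proof -
  let ?M = "lebesgue_on {0<..<T}"
  interpret M: finite_measure ?M by (rule finite_measure_lebesgue_on_Ioo)
  note lebesgue_on_id_measurable[measurable]
  \<comment> \<open>The factor from \<open>exp_kernel_representation\<close>; it is bounded by one
    because \<open>s\<close> is positive on the interval.\<close>
  define \<phi> where "\<phi> u s = (if u < exp (2 * \<gamma> * s) then exp (- \<gamma> * s) else 0)" for u s :: real
  define G where "G s t = exp (- \<gamma> * \<bar>t - s\<bar>) * (x s \<bullet> x t)" for s t
  have [measurable]: "(\<lambda>p. fst p) \<in> borel_measurable (lebesgue_on A \<Otimes>\<^sub>M lebesgue_on B)"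
    "(\<lambda>p. snd p) \<in> borel_measurable (lebesgue_on A \<Otimes>\<^sub>M lebesgue_on B)" for A B :: "real set"
    using measurable_compose[OF measurable_fst lebesgue_on_id_measurable]
      measurable_compose[OF measurable_snd lebesgue_on_id_measurable] by auto
  have "0 \<le> (\<integral>t. \<integral>s. (\<integral>u. \<phi> u s * \<phi> u t \<partial>lebesgue_on {0<..<exp (2 * \<gamma> * T)}) * (x s \<bullet> x t) \<partial>?M \<partial>?M)"
  proof (rule psd_kernel_integral_nonneg[where C = 1])
    show "(\<lambda>(u, s). \<phi> u s) \<in> borel_measurable (lebesgue_on {0<..<exp (2 * \<gamma> * T)} \<Otimes>\<^sub>M ?M)"
      unfolding \<phi>_def split_beta' by measurable
    show "\<bar>\<phi> u s\<bar> \<le> 1" if "s \<in> space ?M" for u s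
      using that \<open>\<gamma> > 0\<close> by (auto simp: \<phi>_def space_restrict_space)
  qed (use finite_measure_lebesgue_on_Ioo x in \<open>auto\<close>)
  also have "\<dots> = (\<integral>t. \<integral>s. G s t \<partial>?M \<partial>?M)"
    using exp_kernel_representation[OF \<open>\<gamma> > 0\<close>, of _ T]
    by (intro Bochner_Integration.integral_cong refl)
      (simp add: \<phi>_def G_def space_restrict_space)
  \<comment> \<open>Passage from the square to the triangle \<open>s < t\<close>, which up to the
    factor \<open>\<gamma>\<close> is the convolution form.\<close>
  also have "\<dots> = 2 * (\<integral>t. \<integral>s. (if s < t then G s t else 0) \<partial>?M \<partial>?M)"
  proof (rule triangle_integral_symmetric)
    show "sigma_finite_measure ?M" ..
    have "integrable (?M \<Otimes>\<^sub>M ?M) (\<lambda>(s, t). (\<lambda>(s, t). exp (- \<gamma> * \<bar>t - s\<bar>)) (s, t) * (x s \<bullet> x t))"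
      by (rule integrable_pair_inner[where C = 1])
        (use M.finite_measure_axioms x \<open>\<gamma> > 0\<close> in \<open>auto simp: split_beta'\<close>)
    then show "integrable (?M \<Otimes>\<^sub>M ?M) (\<lambda>(s, t). G s t)" by (simp add: G_def)
    show "Measurable.pred (?M \<Otimes>\<^sub>M ?M) (\<lambda>(s, t). s < t)"
      unfolding split_beta' by measurable
    show "G s t = G t s" for s t by (simp add: G_def inner_commute abs_minus_commute)
  qed (rule AE_lebesgue_on_neq)
  finally have "0 \<le> (\<integral>t. \<integral>s. (if s < t then G s t else 0) \<partial>?M \<partial>?M)" by simp
  moreover have "(\<integral>t. conv (exp_kernel \<gamma>) x t \<bullet> x t \<partial>?M)
      = (\<integral>t. \<gamma> * (\<integral>s. (if s < t then G s t else 0) \<partial>?M) \<partial>?M)"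
    by (intro Bochner_Integration.integral_cong refl)
      (simp add: G_def conv_exp_kernel_inner[OF x _ \<open>\<gamma> > 0\<close>] space_restrict_space cong: if_cong)
  ultimately show ?thesis using \<open>\<gamma> > 0\<close> by simp
qed

section \<open>Failure of coercivity\<close>

text \<open>For \<open>t\<close> in \<open>(0, d)\<close> the kernel has norm at most
  \<open>\<gamma>\<close> and acts over a length below \<open>d\<close>, so the convolution has norm
  at most \<open>\<gamma> * d * norm e\<close>. Pairing with \<open>e\<close> and integrating over
  \<open>(0, d)\<close> gives the second factor \<open>d\<close>; elsewhere \<open>x t\<close>
  vanishes.\<close>

lemma exp_kernel_form_indicator_le:
  fixes e :: "'h::{real_inner, banach, second_countable_topology}"
  assumes "\<gamma> > 0" "0 < d" "d < T"
  defines "x \<equiv> \<lambda>t::real. indicator {0<..<d} t *\<^sub>R e"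
  shows "(\<integral>t. conv (exp_kernel \<gamma>) x t \<bullet> x t \<partial>lebesgue_on {0<..<T}) \<le> \<gamma> * d\<^sup>2 * (norm e)\<^sup>2"
proof -
  have conv: "norm (conv (exp_kernel \<gamma>) x t) \<le> \<gamma> * d * norm e" if t: "0 < t" "t < d" for t
  proof -
    interpret finite_measure "lebesgue_on {0<..<t}" by (rule finite_measure_lebesgue_on_Ioo)
    have "norm (conv (exp_kernel \<gamma>) x t)
        \<le> (\<integral>s. norm (blinfun_apply (exp_kernel \<gamma> (t - s)) (x s)) \<partial>lebesgue_on {0<..<t})"
      unfolding conv_def by (rule integral_norm_bound)
    also have "\<dots> \<le> (\<integral>s. \<gamma> * norm e \<partial>lebesgue_on {0<..<t})"
      using \<open>\<gamma> > 0\<close>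
      by (intro integral_mono')
        (auto simp: x_def exp_kernel_def blinfun.scaleR_left indicator_def abs_mult space_restrict_space
          intro!: mult_left_le_one_le)
    also have "\<dots> = t * (\<gamma> * norm e)"
      using t by (simp add: measure_restrict_space space_restrict_space)
    also have "\<dots> \<le> \<gamma> * d * norm e"
      using t \<open>\<gamma> > 0\<close> by (simp add: mult_right_mono mult_ac mult_left_mono)
    finally show ?thesis .
  qed
  interpret finite_measure "lebesgue_on {0<..<T}" by (rule finite_measure_lebesgue_on_Ioo)
  have "(\<integral>t. conv (exp_kernel \<gamma>) x t \<bullet> x t \<partial>lebesgue_on {0<..<T})
      \<le> (\<integral>t. \<gamma> * d * (norm e)\<^sup>2 * indicator {0<..<d} t \<partial>lebesgue_on {0<..<T})"
  \<comment> \<open>This rule asks for integrability and nonnegativity of the majorant only, so the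
    convolution is estimated pointwise without discussing its measurability in
    \<open>t\<close>.\<close>
  proof (rule integral_mono')
    have "{0<..<d} \<in> sets (lebesgue_on {0<..<T})"
      using assms by (auto simp: sets_restrict_space_iff)
    then show "integrable (lebesgue_on {0<..<T}) (\<lambda>t. \<gamma> * d * (norm e)\<^sup>2 * indicator {0<..<d} t)"
      by (intro integrable_mult_right integrable_real_indicator) (simp_all add: less_top[symmetric])
    show "conv (exp_kernel \<gamma>) x t \<bullet> x t \<le> \<gamma> * d * (norm e)\<^sup>2 * indicator {0<..<d} t" for t
    proof (cases "t \<in> {0<..<d}")
      case True
      have "conv (exp_kernel \<gamma>) x t \<bullet> e \<le> norm (conv (exp_kernel \<gamma>) x t) * norm e"
        by (rule norm_cauchy_schwarz)
      also have "\<dots> \<le> (\<gamma> * d * norm e) * norm e"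
        using conv True by (intro mult_right_mono) auto
      finally show ?thesis using True by (simp add: x_def power2_eq_square mult_ac)
    qed (simp add: x_def)
  qed (use assms in \<open>auto\<close>)
  also have "\<dots> = \<gamma> * d * (norm e)\<^sup>2 * measure (lebesgue_on {0<..<T}) {0<..<d}"
    using assms by (simp add: Int_absorb2 subset_iff)
  also have "\<dots> = \<gamma> * d\<^sup>2 * (norm e)\<^sup>2"
    using assms by (subst measure_restrict_space) (auto simp: power2_eq_square)
  finally show ?thesis .
qed

text \<open>The squared norm is linear in \<open>d\<close>, to be set against the quadratic bound on
  the form.\<close>

lemma indicator_L2:
  fixes e :: "'h::{real_inner, banach, second_countable_topology}"
  assumes "0 < d" "d < T"
  defines "x \<equiv> \<lambda>t::real. indicator {0<..<d} t *\<^sub>R e"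
  shows "x \<in> L2_space (lebesgue_on {0<..<T})"
    and "(L2_norm (lebesgue_on {0<..<T}) x)\<^sup>2 = d * (norm e)\<^sup>2"
proof -
  interpret finite_measure "lebesgue_on {0<..<T}" by (rule finite_measure_lebesgue_on_Ioo)
  have [measurable]: "{0<..<d} \<in> sets (lebesgue_on {0<..<T})"
    using assms by (auto simp: sets_restrict_space_iff)
  have x2: "(norm (x t))\<^sup>2 = (norm e)\<^sup>2 * indicator {0<..<d} t" for t
    by (simp add: x_def indicator_def)
  show "x \<in> L2_space (lebesgue_on {0<..<T})"
    unfolding L2_space_def x2 mem_Collect_eq
    by (intro conjI integrable_mult_right integrable_real_indicator)
      (simp_all add: x_def less_top[symmetric])
  have "(\<integral>t. (norm (x t))\<^sup>2 \<partial>lebesgue_on {0<..<T}) = (norm e)\<^sup>2 * measure (lebesgue_on {0<..<T}) {0<..<d}"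
    unfolding x2 using assms by (simp add: Int_absorb2 subset_iff)
  also have "\<dots> = d * (norm e)\<^sup>2"
    using assms by (subst measure_restrict_space) auto
  finally show "(L2_norm (lebesgue_on {0<..<T}) x)\<^sup>2 = d * (norm e)\<^sup>2"
    using assms by (simp add: L2_norm_def)
qed

theorem proposition3p9:
  fixes \<gamma> T :: real
  assumes "(UNIV :: 'h::{real_inner, banach, second_countable_topology} set) \<noteq> {0}"
    and "\<gamma> > 0" and "T > 0"
  shows "(\<forall>x::real \<Rightarrow> 'h. x \<in> L2_space (lebesgue_on {0<..<T}) \<longrightarrow>
            (\<integral>t. conv (exp_kernel \<gamma>) x t \<bullet> x t \<partial>lebesgue_on {0<..<T}) \<ge> 0)
       \<and> \<not> (\<exists>c>0. \<forall>x::real \<Rightarrow> 'h. x \<in> L2_space (lebesgue_on {0<..<T}) \<longrightarrow>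
            (\<integral>t. conv (exp_kernel \<gamma>) x t \<bullet> x t \<partial>lebesgue_on {0<..<T})
              \<ge> c * (L2_norm (lebesgue_on {0<..<T}) x)\<^sup>2)"
proof (intro conjI allI impI notI)
  show "0 \<le> (\<integral>t. conv (exp_kernel \<gamma>) x t \<bullet> x t \<partial>lebesgue_on {0<..<T})"
    if "x \<in> L2_space (lebesgue_on {0<..<T})" for x :: "real \<Rightarrow> 'h"
    \<comment> \<open>Nonnegativity was shown for integrable \<open>x\<close>; on a bounded interval
      this covers every square-integrable \<open>x\<close>.\<close>
    using exp_kernel_form_nonneg[OF \<open>\<gamma> > 0\<close>]
      L2_space_imp_integrable[OF finite_measure_lebesgue_on_Ioo that] .
next
  assume "\<exists>c>0. \<forall>x::real \<Rightarrow> 'h. x \<in> L2_space (lebesgue_on {0<..<T}) \<longrightarrow>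
            (\<integral>t. conv (exp_kernel \<gamma>) x t \<bullet> x t \<partial>lebesgue_on {0<..<T})
              \<ge> c * (L2_norm (lebesgue_on {0<..<T}) x)\<^sup>2"
  then obtain c where "c > 0" and c: "\<And>x::real \<Rightarrow> 'h. x \<in> L2_space (lebesgue_on {0<..<T}) \<Longrightarrow>
      c * (L2_norm (lebesgue_on {0<..<T}) x)\<^sup>2 \<le> (\<integral>t. conv (exp_kernel \<gamma>) x t \<bullet> x t \<partial>lebesgue_on {0<..<T})"
    by blast
  obtain e :: 'h where "e \<noteq> 0" using assms(1) by auto
  \<comment> \<open>The bound \<open>T / 2\<close> keeps the support inside the interval, and
    \<open>c / (2 * \<gamma>)\<close> forces \<open>\<gamma> * d \<le> c / 2\<close>, against the
    \<open>c \<le> \<gamma> * d\<close> that coercivity would give.\<close>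
  define d where "d = min (T / 2) (c / (2 * \<gamma>))"
  have d: "0 < d" "d < T" "d \<le> c / (2 * \<gamma>)"
    using \<open>c > 0\<close> \<open>\<gamma> > 0\<close> \<open>T > 0\<close> by (auto simp: d_def)
  have "\<gamma> * d \<le> c / 2" using d(3) \<open>\<gamma> > 0\<close> by (simp add: field_simps)
  have "c * (d * (norm e)\<^sup>2) \<le> \<gamma> * d\<^sup>2 * (norm e)\<^sup>2"
    using c[OF indicator_L2(1)[OF d(1,2), of e]] indicator_L2(2)[OF d(1,2), of e]
      exp_kernel_form_indicator_le[OF \<open>\<gamma> > 0\<close> d(1,2), of e] by simp
  \<comment> \<open>Cancellation of the positive factor \<open>d * (norm e)\<^sup>2\<close>; this is
    where a nonzero vector is used.\<close>
  then have "c \<le> \<gamma> * d"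
    using d(1) \<open>e \<noteq> 0\<close> by (simp add: power2_eq_square mult.assoc[symmetric])
  then show False using \<open>\<gamma> * d \<le> c / 2\<close> \<open>c > 0\<close> by simp
qed

end
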